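(* For $a, b \in \mathbb{N}_0$ and $c \in \{1, 3, 5\}$ let $$RR_5(a,b,c)=\frac{(6a+5)\cdot 2^{\,2\left(3b+\left((c-(a \bmod 3))\bmod 3\right)\right)+1}-1}{3}.$$ Then $RR_5$ is a function $\mathbb{N}_0 \times \mathbb{N}_0 \times \{1, 3, 5\} \to \mathbb{O}_{R5}$, and $RR_5(a,b,c) \equiv c \pmod{6}$ for all $a,b\in\mathbb{N}_0$ and $c\in\{1,3,5\}$.
   Context: $\mathbb{N}_0$ denotes the nonnegative integers. $x \bmod 3\in\{0,1,2\}$ is the (nonnegative) remainder of the integer $x$ modulo $3$, also when $x$ is negative. The function $R_5$ is defined for $a,b\in\mathbb{N}_0$ by $R_5(a,b) = \frac{(6a+5)\cdot 2^{2b+1}-1}{3}$, and $\mathbb{O}_{R5} = \{R_5(a,b) : a,b\in\mathbb{N}_0\}$, a subset of the positive odd integers. *)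

theory Defs
  imports Complex_Main "HOL-Library.FuncSet" "HOL-Number_Theory.Cong"
begin

text \<open>
  The quotients by 3 are exact divisions in the rationals, not truncating integer division,
  so no integrality is built into the definitions.
\<close>

definition R5 :: "nat \<Rightarrow> nat \<Rightarrow> rat" where
  "R5 a b = ((6 * of_nat a + 5) * 2 ^ (2 * b + 1) - 1) / 3"

definition O_R5 :: "rat set" where
  "O_R5 = {R5 a b | a b. True}"

text \<open>
  The difference of c and a mod 3 can be negative, so it is formed in the integers, where the
  remainder modulo 3 is nonnegative; \<open>nat\<close> only turns this remainder into an exponent.
\<close>

definition RR5 :: "nat \<Rightarrow> nat \<Rightarrow> nat \<Rightarrow> rat" where
  "RR5 a b c =
     ((6 * of_nat a + 5) * 2 ^ (2 * (3 * b + nat ((int c - int (a mod 3)) mod 3)) + 1) - 1) / 3"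

end

theory Submission
  imports Defs
begin

text \<open>
  Modulo 18, the numerator plus one, \<open>(6 a + 5) * 2 ^ (2 e + 1)\<close>, depends only on \<open>a mod 3\<close>
  and \<open>e mod 3\<close>, because \<open>2 * 64 \<equiv> 2\<close>. It therefore suffices to compare it with
  \<open>3 c + 1\<close> in the nine cases for \<open>a mod 3\<close> and \<open>c\<close>.
\<close>

text \<open>Since \<open>64 = 7 * 9 + 1\<close>, powers of 64 are 1 modulo 9, and the factor 2 lifts
  this to modulus 18; 64 itself is 10 modulo 18.\<close>

lemma two_mult_64_power_cong: "[2 * 64 ^ b = (2::int)] (mod 18)"
proof (induction b)
  case (Suc b)
  have "[64 * (2 * 64 ^ b) = 64 * (2::int)] (mod 18)"
    using Suc by (rule cong_scalar_left)
  also have "[64 * 2 = (2::int)] (mod 18)"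
    by (simp add: cong_def)
  finally show ?case
    by (simp add: ac_simps)
qed simp

lemma numerator_cong_reduce:
  "[(6 * int a + 5) * 2 ^ (2 * (3 * b + k) + 1) = (6 * int (a mod 3) + 5) * 2 ^ (2 * k + 1)] (mod 18)"
proof -
  have "int a = 3 * int (a div 3) + int (a mod 3)"
    by (metis mult_div_mod_eq of_nat_add of_nat_mult of_nat_numeral)
  then have "6 * int a + 5 = (6 * int (a mod 3) + 5) + 18 * int (a div 3)"
    by linarith
  then have "[6 * int a + 5 = 6 * int (a mod 3) + 5] (mod 18)"
    by (simp only: cong_def mod_mult_self2)
  moreover have "(2::int) ^ (2 * (3 * b + k) + 1) = 2 * 64 ^ b * 4 ^ k"
    by (simp add: power_add power_mult)
  moreover have "[2 * 64 ^ b * 4 ^ k = 2 * (4::int) ^ k] (mod 18)"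
    using two_mult_64_power_cong by (rule cong_scalar_right)
  ultimately show ?thesis
    using cong_mult by (fastforce simp: power_mult mult.assoc)
qed

text \<open>Why the nine cases agree: with \<open>r = a mod 3\<close>, modulo 9 one has
  \<open>2 * (6 * r + 5) = 1 + 3 * r\<close> and \<open>4 ^ k = 1 + 3 * k\<close>, with product
  \<open>1 + 3 * (r + k)\<close>. The offset \<open>k\<close> in the exponent makes
  \<open>r + k\<close> congruent to \<open>c\<close> modulo 3. Both sides are even because
  \<open>c\<close> is odd.\<close>

lemma numerator_cong:
  assumes "c \<in> {1, 3, 5}"
  shows "[(6 * int a + 5) * 2 ^ (2 * (3 * b + nat ((int c - int (a mod 3)) mod 3)) + 1)
    = 3 * int c + 1] (mod 18)"
proof -
  have "a mod 3 \<in> {0, 1, 2}"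
    by auto
  then have "[(6 * int (a mod 3) + 5) * 2 ^ (2 * nat ((int c - int (a mod 3)) mod 3) + 1)
      = 3 * int c + 1] (mod 18)"
    \<comment> \<open>Keeping \<open>int (a mod 3)\<close> intact lets each case substitute its
      residue.\<close>
    using assms by (auto simp: cong_def simp del: of_nat_mod)
  with numerator_cong_reduce show ?thesis
    by (rule cong_trans)
qed

theorem theorem5p18:
  shows "(\<lambda>(a, b, c). RR5 a b c) \<in> (UNIV :: nat set) \<times> (UNIV :: nat set) \<times> {1, 3, 5} \<rightarrow> O_R5 \<and>
    (\<forall>(a::nat) (b::nat). \<forall>c \<in> {1, 3, 5 :: nat}.
       \<exists>n::int. RR5 a b c = of_int n \<and> [n = int c] (mod 6))"
proof (intro conjI allI ballI)
  show "(\<lambda>(a, b, c). RR5 a b c) \<in> UNIV \<times> UNIV \<times> {1, 3, 5} \<rightarrow> O_R5"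
  proof -
    have "RR5 a b c = R5 a (3 * b + nat ((int c - int (a mod 3)) mod 3))" for a b c
      by (simp only: RR5_def R5_def)
    then show ?thesis
      unfolding O_R5_def by auto
  qed
next
  fix a b c :: nat
  assume "c \<in> {1, 3, 5}"
  define m where "m = 2 * (3 * b + nat ((int c - int (a mod 3)) mod 3)) + 1"
  have "[(6 * int a + 5) * 2 ^ m = 3 * int c + 1] (mod 18)"
    unfolding m_def using \<open>c \<in> {1, 3, 5}\<close> by (rule numerator_cong)
  \<comment> \<open>As \<open>18 = 3 * 6\<close>, the quotient by 3 is an integer determined modulo
    6; \<open>int c + 6 * t\<close> is the witness for \<open>n\<close>.\<close>
  then obtain t where "(6 * int a + 5) * 2 ^ m = 3 * int c + 1 + 18 * t"
    by (metis cong_iff_lin cong_sym)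
  then have "(6 * int a + 5) * 2 ^ m - 1 = 3 * (int c + 6 * t)"
    by simp
  then have "(of_int ((6 * int a + 5) * 2 ^ m - 1) :: rat) = of_int (3 * (int c + 6 * t))"
    by (rule arg_cong)
  then have "RR5 a b c = of_int (int c + 6 * t)"
    unfolding RR5_def m_def[symmetric] by simp
  moreover have "[int c + 6 * t = int c] (mod 6)"
    by (simp add: cong_def)
  ultimately show "\<exists>n::int. RR5 a b c = of_int n \<and> [n = int c] (mod 6)"
    by blast
qed

end
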